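(* Let $2\leq m\leq n$ be integers and let $G=L_{n\times m}$ be the $n\times m$ rectangular grid. If $G$ is a ladder graph (i.e., $m=2$), then $s(G)=3$; otherwise, $s(G)=4$.
   Context: A vertex labeling of a graph $G$ is an injective map $f:V(G)\to\mathbb{Z}$. It induces the edge labeling $f^+:E(G)\to\mathbb{Z}$, $f^+(uv)=f(u)+f(v)$, and $|f^+|$ denotes the number of distinct values $f^+$ takes on $E(G)$. The sum index $s(G)$ is the minimum positive integer $k$ such that there exists a vertex labeling $f$ of $G$ with $|f^+|=k$. For integers $2\leq m\leq n$, the $n\times m$ rectangular grid $L_{n\times m}$ is the graph with vertex set $\{v_{i,j}:0\leq i\leq n-1,\ 0\leq j\leq m-1\}$ and edge set $\{v_{i,j}v_{i',j'}:|i-i'|+|j-j'|=1\}$. A ladder graph is a rectangular grid $L_{n\times2}$. *)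

theory Defs
  imports "Graph_Theory.Pair_Digraph"
begin

text \<open>
  Undirected graphs are represented, as usual in \<open>Graph_Theory\<close>, by symmetric pair digraphs:
  an edge \<open>uv\<close> is the pair of arcs \<open>(u, v)\<close>, \<open>(v, u)\<close>, on which an induced edge
  labeling takes the same value.
\<close>

definition vertex_labeling :: "'a pair_pre_digraph \<Rightarrow> ('a \<Rightarrow> int) \<Rightarrow> bool" where
  "vertex_labeling G f \<longleftrightarrow> inj_on f (pverts G)"

definition edge_label :: "('a \<Rightarrow> int) \<Rightarrow> 'a \<times> 'a \<Rightarrow> int" where
  "edge_label f e = f (fst e) + f (snd e)"

definition num_edge_labels :: "'a pair_pre_digraph \<Rightarrow> ('a \<Rightarrow> int) \<Rightarrow> nat" where
  "num_edge_labels G f = card (edge_label f ` parcs G)"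

text \<open>
  The minimum exists for every finite graph with at least one edge; otherwise the value is
  unspecified.
\<close>
definition sum_index :: "'a pair_pre_digraph \<Rightarrow> nat" where
  "sum_index G = (LEAST k. 0 < k \<and> (\<exists>f. vertex_labeling G f \<and> num_edge_labels G f = k))"

definition rect_grid :: "nat \<Rightarrow> nat \<Rightarrow> (nat \<times> nat) pair_pre_digraph" where
  "rect_grid n m =
    \<lparr> pverts = {..<n} \<times> {..<m},
      parcs = {((i, j), (i', j')) | i j i' j'.
        i < n \<and> j < m \<and> i' < n \<and> j' < m \<and> \<bar>int i - int i'\<bar> + \<bar>int j - int j'\<bar> = 1} \<rparr>"

lemma pair_graph_rect_grid: "pair_graph (rect_grid n m)"
proof
  show "finite (pverts (rect_grid n m))"
    by (simp add: rect_grid_def)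
  have "parcs (rect_grid n m) \<subseteq> pverts (rect_grid n m) \<times> pverts (rect_grid n m)"
    by (auto simp: rect_grid_def)
  then show "finite (parcs (rect_grid n m))"
    by (rule finite_subset) (simp add: rect_grid_def)
  have "sym (parcs (rect_grid n m))"
    by (auto simp: sym_def rect_grid_def)
  then show "symmetric (with_proj (rect_grid n m))"
    by (simp add: symmetric_def arcs_ends_def arc_to_ends_def)
qed (auto simp: rect_grid_def)

end

theory Submission
  imports Defs
begin

text \<open>
  Lower bounds come from local configurations. Two edges that share an endpoint get different
  labels, because the labeling is injective at their other endpoints; hence the sum index is at
  least every vertex degree, and a grid with \<open>m \<ge> 3\<close> has a vertex of degree 4. In a
  ladder the same remark leaves a 4-cycle with two labels only if both pairs of opposite edges
  agree, which is impossible, so three labels occur.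

  Upper bounds come from the labelings \<open>(-1)\<^sup>i\<^sup>+\<^sup>j (a i + b j + 1)\<close>. Adjacent vertices get opposite
  signs, so the affine parts cancel to \<open>\<plusminus>a\<close> along the first coordinate and to
  \<open>\<plusminus>b\<close> along the second, and only four labels are possible. The choice \<open>a = m\<close>,
  \<open>b = 1\<close> makes the absolute values the row-by-row numbering \<open>1, 2, \<dots>, n m\<close> of the vertices. When
  \<open>m = 2\<close>, the choice \<open>a = 1\<close>, \<open>b = 0\<close> is still injective: a rung carries
  opposite nonzero labels, and the two edge labels \<open>\<plusminus>b\<close> merge into one.
\<close>

lemma sum_index_eqI:
  assumes "0 < k" and "vertex_labeling G f" and "num_edge_labels G f \<le> k"
    and lower: "\<And>g. vertex_labeling G g \<Longrightarrow> k \<le> num_edge_labels G g"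
  shows "sum_index G = k"
  unfolding sum_index_def
proof (rule Least_equality)
  show "0 < k \<and> (\<exists>f. vertex_labeling G f \<and> num_edge_labels G f = k)"
    using assms by (meson le_antisym)
qed (use lower in auto)

lemma card_neighbours_le_num_edge_labels:
  assumes "pair_graph G" and "vertex_labeling G f"
    and nbrs: "\<And>w. w \<in> W \<Longrightarrow> (v, w) \<in> parcs G"
  shows "card W \<le> num_edge_labels G f"
proof -
  interpret pair_graph G by fact
  have "W \<subseteq> pverts G"
    using nbrs in_arcsD2 by blast
  then have "inj_on (\<lambda>w. edge_label f (v, w)) W"
    using assms(2) by (auto simp: inj_on_def vertex_labeling_def edge_label_def)
  moreover have "(\<lambda>w. edge_label f (v, w)) ` W \<subseteq> edge_label f ` parcs G"
    using nbrs by auto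
  ultimately show ?thesis
    unfolding num_edge_labels_def
    by (metis card_image card_mono finite_imageI pair_finite_arcs)
qed

text \<open>
  Consecutive edges of the cycle have different labels. If both pairs of opposite edges agreed,
  then \<open>f a + f b = f c + f d\<close> and \<open>f b + f c = f d + f a\<close>, whose difference gives
  \<open>f a = f c\<close>. So some pair of opposite edges disagrees, and either edge between them
  supplies a third label.
\<close>
lemma four_cycle_num_edge_labels:
  assumes "pair_graph G" and "vertex_labeling G f"
    and cycle: "(a, b) \<in> parcs G" "(b, c) \<in> parcs G" "(c, d) \<in> parcs G" "(d, a) \<in> parcs G"
    and "a \<noteq> c" and "b \<noteq> d"
  shows "3 \<le> num_edge_labels G f"
proof -
  interpret pair_graph G by fact
  have "a \<in> pverts G" "b \<in> pverts G" "c \<in> pverts G" "d \<in> pverts G"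
    using cycle in_arcsD1 by blast+
  then have diag: "f a \<noteq> f c" "f b \<noteq> f d"
    using assms(2) \<open>a \<noteq> c\<close> \<open>b \<noteq> d\<close> by (auto simp: vertex_labeling_def inj_on_eq_iff)
  define S where "S = edge_label f ` parcs G"
  have "finite S"
    by (simp add: S_def)
  have mem: "f a + f b \<in> S" "f b + f c \<in> S" "f c + f d \<in> S" "f d + f a \<in> S"
    using cycle by (force simp: S_def edge_label_def image_iff)+
  have card3: "card {x, y, z} = 3" if "x \<noteq> y" "y \<noteq> z" "z \<noteq> x" for x y z :: int
    using that by simp
  have "\<exists>T \<subseteq> S. card T = 3"
  proof (cases "f a + f b = f c + f d")
    case True
    then have "card {f b + f c, f c + f d, f d + f a} = 3"
      by (intro card3; use diag in linarith)
    then show ?thesis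
      using mem by (intro exI[of _ "{f b + f c, f c + f d, f d + f a}"]) simp
  next
    case False
    then have "card {f a + f b, f b + f c, f c + f d} = 3"
      by (intro card3; use diag in linarith)
    then show ?thesis
      using mem by (intro exI[of _ "{f a + f b, f b + f c, f c + f d}"]) simp
  qed
  then show ?thesis
    unfolding num_edge_labels_def S_def[symmetric] using \<open>finite S\<close> by (metis card_mono)
qed

definition alternating_affine :: "int \<Rightarrow> int \<Rightarrow> nat \<times> nat \<Rightarrow> int" where
  "alternating_affine a b = (\<lambda>(i, j). (-1) ^ (i + j) * (a * int i + b * int j + 1))"

lemma grid_arc_cases:
  assumes "((i, j), (i', j')) \<in> parcs (rect_grid n m)"
  obtains "i' = Suc i" "j' = j" | "i = Suc i'" "j' = j" | "i' = i" "j' = Suc j" | "i' = i" "j = Suc j'"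
proof -
  have "\<bar>int i - int i'\<bar> + \<bar>int j - int j'\<bar> = 1"
    using assms by (simp add: rect_grid_def)
  then have "(i' = Suc i \<and> j' = j) \<or> (i = Suc i' \<and> j' = j) \<or>
      (i' = i \<and> j' = Suc j) \<or> (i' = i \<and> j = Suc j')"
    by linarith
  then show thesis using that by blast
qed

lemma alternating_affine_edge_labels:
  "edge_label (alternating_affine a b) ` parcs (rect_grid n m) \<subseteq> {a, -a, b, -b}"
proof (rule image_subsetI)
  fix e assume e: "e \<in> parcs (rect_grid n m)"
  obtain i j i' j' where eq: "e = ((i, j), (i', j'))"
    by (metis surj_pair)
  show "edge_label (alternating_affine a b) e \<in> {a, -a, b, -b}"
    by (rule grid_arc_cases[OF e[unfolded eq]])
      (auto simp: eq edge_label_def alternating_affine_def minus_one_power_iff algebra_simps)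
qed

text \<open>
  The absolute value \<open>m i + j + 1\<close> determines the vertex: since \<open>j < m\<close>, the coordinates are
  the quotient and the remainder of \<open>m i + j\<close> by \<open>m\<close>.
\<close>
lemma vertex_labeling_row_by_row:
  "vertex_labeling (rect_grid n m) (alternating_affine (int m) 1)"
  unfolding vertex_labeling_def
proof (rule inj_onI, clarify)
  fix i j i' j'
  assume v: "(i, j) \<in> pverts (rect_grid n m)" "(i', j') \<in> pverts (rect_grid n m)"
    and eq: "alternating_affine (int m) 1 (i, j) = alternating_affine (int m) 1 (i', j')"
  have abs: "\<bar>alternating_affine (int m) 1 (k, l)\<bar> = int (m * k + l + 1)" for k l
    by (simp add: alternating_affine_def abs_mult power_abs)
  have lt: "j < m" "j' < m"
    using v by (auto simp: rect_grid_def)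
  have sum: "m * i + j = m * i' + j'"
    using abs[of i j] abs[of i' j'] eq by linarith
  have "(m * i + j) div m = i" "(m * i' + j') div m = i'"
    using lt by auto
  then show "i = i' \<and> j = j'"
    using sum by auto
qed

text \<open>
  The absolute value \<open>i + 1\<close> determines the rung, and the sign distinguishes its two ends.
\<close>
lemma vertex_labeling_ladder:
  "vertex_labeling (rect_grid n 2) (alternating_affine 1 0)"
  unfolding vertex_labeling_def
proof (rule inj_onI, clarify)
  fix i j i' j'
  assume v: "(i, j) \<in> pverts (rect_grid n 2)" "(i', j') \<in> pverts (rect_grid n 2)"
    and eq: "alternating_affine 1 0 (i, j) = alternating_affine 1 0 (i', j')"
  have abs: "\<bar>alternating_affine 1 0 (k, l)\<bar> = int k + 1" for k l
    by (simp add: alternating_affine_def abs_mult power_abs)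
  have i: "i = i'"
    using abs[of i j] abs[of i' j'] eq by linarith
  have "j < 2" "j' < 2"
    using v by (auto simp: rect_grid_def)
  then show "i = i' \<and> j = j'"
    using eq i
    by (auto simp: alternating_affine_def minus_one_power_iff less_2_cases_iff split: if_splits)
qed

theorem theorem2p12:
  fixes n m :: nat
  assumes "2 \<le> m" and "m \<le> n"
  shows "sum_index (rect_grid n m) = (if m = 2 then 3 else 4)"
proof (cases "m = 2")
  case True
  have "sum_index (rect_grid n 2) = 3"
  proof (rule sum_index_eqI[where f = "alternating_affine 1 0"])
    have "num_edge_labels (rect_grid n 2) (alternating_affine 1 0) \<le> card {1, -1, 0 :: int}"
      unfolding num_edge_labels_def
      using alternating_affine_edge_labels[of 1 0 n 2] by (intro card_mono) auto
    then show "num_edge_labels (rect_grid n 2) (alternating_affine 1 0) \<le> 3"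
      by simp
  next
    fix g assume "vertex_labeling (rect_grid n 2) g"
    then show "3 \<le> num_edge_labels (rect_grid n 2) g"
      by (rule four_cycle_num_edge_labels[OF pair_graph_rect_grid,
            where a = "(0, 0)" and b = "(1, 0)" and c = "(1, 1)" and d = "(0, 1)"])
        (use assms in \<open>auto simp: rect_grid_def\<close>)
  qed (simp_all add: vertex_labeling_ladder)
  then show ?thesis
    using True by simp
next
  case False
  then have "3 \<le> m" "3 \<le> n"
    using assms by auto
  have "sum_index (rect_grid n m) = 4"
  proof (rule sum_index_eqI[where f = "alternating_affine (int m) 1"])
    have "num_edge_labels (rect_grid n m) (alternating_affine (int m) 1)
        \<le> card {int m, - int m, 1, -1}"
      unfolding num_edge_labels_def
      using alternating_affine_edge_labels by (intro card_mono) auto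
    also have "\<dots> \<le> 4"
      by (simp add: card_insert_if)
    finally show "num_edge_labels (rect_grid n m) (alternating_affine (int m) 1) \<le> 4" .
  next
    fix g assume g: "vertex_labeling (rect_grid n m) g"
    \<comment> \<open>Since \<open>3 \<le> m\<close> and \<open>3 \<le> n\<close>, the vertex \<open>(1, 1)\<close> is interior and has degree 4.\<close>
    let ?W = "{(0, 1), (2, 1), (1, 0), (1, 2)} :: (nat \<times> nat) set"
    have "card ?W \<le> num_edge_labels (rect_grid n m) g"
      by (rule card_neighbours_le_num_edge_labels[OF pair_graph_rect_grid g, where v = "(1, 1)"])
        (use \<open>3 \<le> m\<close> \<open>3 \<le> n\<close> in \<open>auto simp: rect_grid_def\<close>)
    then show "4 \<le> num_edge_labels (rect_grid n m) g"
      by simp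
  qed (simp_all add: vertex_labeling_row_by_row)
  then show ?thesis
    using False by simp
qed

end
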